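(* A cirquent is provable in $\mathbf{CL5}$ iff it is an instance of a binary tautology.
   Context: Formulas are built from infinitely many propositional atoms using $\neg$ (applied only to atoms; $\neg\neg F$ abbreviates $F$, and $\neg$ of a compound formula is understood via De Morgan's laws), $\wedge$ and $\vee$. A $k$-ary cirquent is a pair consisting of a pool, i.e. a sequence $\langle F_1,\ldots,F_k\rangle$ of formulas (their occurrences are called oformulas), and a structure, i.e. a finite sequence of groups, each group being a subset of $\{1,\ldots,k\}$, thought of as the set of oformulas it contains (occurrences of groups are called ogroups). A formula $F$ is identified with the cirquent with pool $\langle F\rangle$ and structure $\langle\{1\}\rangle$. A classical model assigns a truth value to each atom and extends to formulas in the standard way. A group of a cirquent is true in a model iff at least one of its oformulas is true; a cirquent is true in a model iff all of its groups are true; a cirquent is a tautology iff it is true in every model. A cirquent is binary iff no atom has more than two occurrences in it; a binary tautology is a binary cirquent that is a tautology. A substitution $\sigma$ sends each atom to a formula, extended by $\sigma(\neg P)=\neg\sigma(P)$, $\sigma(F\wedge G)=\sigma(F)\wedge\sigma(G)$, $\sigma(F\vee G)=\sigma(F)\vee\sigma(G)$, and to cirquents by applying it to every oformula; $B$ is an instance of $A$ iff $B=\sigma(A)$ for some substitution $\sigma$. $\mathbf{CL5}$ is the cirquent calculus system with the following seven rules, and a proof of a cirquent is a tree of cirquents with that cirquent at the root, each node following from its children by a rule (leaves being axioms). (Axioms) the empty cirquent (empty pool and empty structure), and the identity axiom: pool $\langle\neg F,F\rangle$, structure $\langle\{1,2\}\rangle$. (Mix) from two premises, the conclusion places one next to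 the other (concatenating pools and structures). (Exchange) swap two adjacent oformulas, correspondingly redirecting group membership, or swap two adjacent ogroups. (Weakening) add an existing oformula to an existing ogroup, or insert a new oformula anywhere in the pool (belonging to no group). (Duplication) downward: replace an ogroup by two adjacent ogroups identical to it as groups; upward: the converse. ($\vee$-introduction) merge two adjacent oformulas $F,G$ into one oformula $F\vee G$, so that an ogroup of the conclusion contains $F\vee G$ iff the corresponding ogroup of the premise contains at least one of $F,G$. ($\wedge$-introduction) the premise has adjacent oformulas $F,G$ such that no ogroup contains both, every ogroup containing $F$ is immediately followed by an ogroup containing $G$, and every ogroup containing $G$ is immediately preceded by an ogroup containing $F$; the conclusion merges each ogroup containing $F$ with the immediately following ogroup (taking the union), and then merges $F$ and $G$ into the single oformula $F\wedge G$. (The contraction rule, which merges two adjacent identical oformulas, is not included in $\mathbf{CL5}$.) *)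

theory Defs
  imports Main "HOL-Combinatorics.Transposition"
begin

datatype 'a formula =
    Atom 'a
  | NegAtom 'a
  | And "'a formula" "'a formula"
  | Or "'a formula" "'a formula"

primrec neg :: "'a formula \<Rightarrow> 'a formula" where
  "neg (Atom P) = NegAtom P"
| "neg (NegAtom P) = Atom P"
| "neg (And F G) = Or (neg F) (neg G)"
| "neg (Or F G) = And (neg F) (neg G)"

primrec formula_true :: "('a \<Rightarrow> bool) \<Rightarrow> 'a formula \<Rightarrow> bool" where
  "formula_true M (Atom P) \<longleftrightarrow> M P"
| "formula_true M (NegAtom P) \<longleftrightarrow> \<not> M P"
| "formula_true M (And F G) \<longleftrightarrow> formula_true M F \<and> formula_true M G"
| "formula_true M (Or F G) \<longleftrightarrow> formula_true M F \<or> formula_true M G"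

primrec formula_occs :: "'a \<Rightarrow> 'a formula \<Rightarrow> nat" where
  "formula_occs P (Atom Q) = (if P = Q then 1 else 0)"
| "formula_occs P (NegAtom Q) = (if P = Q then 1 else 0)"
| "formula_occs P (And F G) = formula_occs P F + formula_occs P G"
| "formula_occs P (Or F G) = formula_occs P F + formula_occs P G"

primrec formula_subst :: "('a \<Rightarrow> 'a formula) \<Rightarrow> 'a formula \<Rightarrow> 'a formula" where
  "formula_subst \<sigma> (Atom P) = \<sigma> P"
| "formula_subst \<sigma> (NegAtom P) = neg (\<sigma> P)"
| "formula_subst \<sigma> (And F G) = And (formula_subst \<sigma> F) (formula_subst \<sigma> G)"
| "formula_subst \<sigma> (Or F G) = Or (formula_subst \<sigma> F) (formula_subst \<sigma> G)"

text \<open>A cirquent is a pair (pool, structure). Oformulas are identified with their positions in the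
  pool, counted from 0, so the groups of a \<open>k\<close>-ary cirquent are subsets of \<open>{..<k}\<close>; this bound is
  imposed by \<open>is_cirquent\<close>. Groups may be empty.\<close>

type_synonym 'a cirquent = "'a formula list \<times> nat set list"

definition is_cirquent :: "'a cirquent \<Rightarrow> bool" where
  "is_cirquent C \<longleftrightarrow> (\<forall>g \<in> set (snd C). g \<subseteq> {..<length (fst C)})"

definition group_true :: "('a \<Rightarrow> bool) \<Rightarrow> 'a formula list \<Rightarrow> nat set \<Rightarrow> bool" where
  "group_true M p g \<longleftrightarrow> (\<exists>i \<in> g. formula_true M (p ! i))"

definition cirquent_true :: "('a \<Rightarrow> bool) \<Rightarrow> 'a cirquent \<Rightarrow> bool" where
  "cirquent_true M C \<longleftrightarrow> (\<forall>g \<in> set (snd C). group_true M (fst C) g)"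

definition tautology :: "'a cirquent \<Rightarrow> bool" where
  "tautology C \<longleftrightarrow> (\<forall>M. cirquent_true M C)"

text \<open>Occurrences are counted in the pool: an oformula contributes once, no matter how many ogroups
  contain it.\<close>

definition cirquent_occs :: "'a \<Rightarrow> 'a cirquent \<Rightarrow> nat" where
  "cirquent_occs P C = (\<Sum>F \<leftarrow> fst C. formula_occs P F)"

definition binary :: "'a cirquent \<Rightarrow> bool" where
  "binary C \<longleftrightarrow> (\<forall>P. cirquent_occs P C \<le> 2)"

definition binary_tautology :: "'a cirquent \<Rightarrow> bool" where
  "binary_tautology C \<longleftrightarrow> is_cirquent C \<and> binary C \<and> tautology C"

definition cirquent_subst :: "('a \<Rightarrow> 'a formula) \<Rightarrow> 'a cirquent \<Rightarrow> 'a cirquent" where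
  "cirquent_subst \<sigma> C = (map (formula_subst \<sigma>) (fst C), snd C)"

definition instance_of :: "'a cirquent \<Rightarrow> 'a cirquent \<Rightarrow> bool" where
  "instance_of B A \<longleftrightarrow> (\<exists>\<sigma>. B = cirquent_subst \<sigma> A)"

text \<open>Renumberings of pool positions: \<open>open_gap n\<close> makes room for a new oformula at position \<open>n\<close>;
  \<open>collapse n\<close> identifies the positions \<open>n\<close> and \<open>Suc n\<close>.\<close>

definition open_gap :: "nat \<Rightarrow> nat \<Rightarrow> nat" where
  "open_gap n i = (if i < n then i else Suc i)"

definition collapse :: "nat \<Rightarrow> nat \<Rightarrow> nat" where
  "collapse n i = (if i \<le> n then i else i - 1)"

text \<open>The side condition of \<open>\<and>\<close>-introduction on the oformulas at positions \<open>n\<close> and \<open>Suc n\<close>.\<close>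

definition and_ready :: "nat \<Rightarrow> nat set list \<Rightarrow> bool" where
  "and_ready n s \<longleftrightarrow> (\<forall>j < length s.
     \<not> (n \<in> s ! j \<and> Suc n \<in> s ! j) \<and>
     (n \<in> s ! j \<longrightarrow> Suc j < length s \<and> Suc n \<in> s ! Suc j) \<and>
     (Suc n \<in> s ! j \<longrightarrow> 0 < j \<and> n \<in> s ! (j - 1)))"

text \<open>Merges every ogroup containing \<open>n\<close> with its successor. If \<open>and_ready n s\<close> holds, the successor
  never contains \<open>n\<close> itself, so skipping over it is harmless.\<close>

fun merge_groups :: "nat \<Rightarrow> nat set list \<Rightarrow> nat set list" where
  "merge_groups n [] = []"
| "merge_groups n [g] = [g]"
| "merge_groups n (g # h # s) =
     (if n \<in> g then (g \<union> h) # merge_groups n s else g # merge_groups n (h # s))"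

inductive CL5 :: "'a cirquent \<Rightarrow> bool" where
  empty_axiom: "CL5 ([], [])"
| identity_axiom: "CL5 ([neg F, F], [{0, 1}])"
| mix: "CL5 (p, s) \<Longrightarrow> CL5 (q, t) \<Longrightarrow> CL5 (p @ q, s @ map (image (\<lambda>i. length p + i)) t)"
| oformula_exchange: "CL5 (p @ [F, G] @ q, s) \<Longrightarrow>
    CL5 (p @ [G, F] @ q, map (image (transpose (length p) (Suc (length p)))) s)"
| ogroup_exchange: "CL5 (p, s @ [g, h] @ t) \<Longrightarrow> CL5 (p, s @ [h, g] @ t)"
| ogroup_weakening: "CL5 (p, s @ [g] @ t) \<Longrightarrow> i < length p \<Longrightarrow> CL5 (p, s @ [insert i g] @ t)"
| pool_weakening: "CL5 (p @ q, s) \<Longrightarrow>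
    CL5 (p @ [F] @ q, map (image (open_gap (length p))) s)"
| duplication_down: "CL5 (p, s @ [g] @ t) \<Longrightarrow> CL5 (p, s @ [g, g] @ t)"
| duplication_up: "CL5 (p, s @ [g, g] @ t) \<Longrightarrow> CL5 (p, s @ [g] @ t)"
| or_introduction: "CL5 (p @ [F, G] @ q, s) \<Longrightarrow>
    CL5 (p @ [Or F G] @ q, map (image (collapse (length p))) s)"
| and_introduction: "CL5 (p @ [F, G] @ q, s) \<Longrightarrow> and_ready (length p) s \<Longrightarrow>
    CL5 (p @ [And F G] @ q, map (image (collapse (length p))) (merge_groups (length p) s))"

end

theory Submission
  imports Defs "HOL-Library.Multiset"
begin

text \<open>
  Soundness: every rule preserves tautologies, and running a proof with a fresh atom \<open>P\<close> in
  place of \<open>F\<close> in each identity axiom, and a fresh atom for each weakened-in oformula, turns it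
  into a proof of a binary cirquent, of which the original conclusion is an instance;
  contraction is the only rule that would break this.

  Completeness: provability is closed under substitution, so it suffices to prove binary
  tautologies. The rules for \<open>\<or>\<close> and \<open>\<and>\<close> can be inverted, splitting each group that contains a
  conjunction in two, which leaves a pool of literals. There every group contains a
  complementary pair, and since the cirquent is binary, distinct such pairs are disjoint; so
  they come from identity axioms by mix, and the rest is duplication, weakening and exchange.
\<close>

section \<open>Truth of groups under renumbering\<close>

lemma formula_true_neg [simp]: "formula_true M (neg F) \<longleftrightarrow> \<not> formula_true M F"
  by (induction F) auto

lemma cirquent_true_Pair [simp]: "cirquent_true M (p, s) \<longleftrightarrow> (\<forall>g\<in>set s. group_true M p g)"
  by (simp add: cirquent_true_def)

lemma group_true_mono: "group_true M p g \<Longrightarrow> g \<subseteq> h \<Longrightarrow> group_true M p h"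
  by (auto simp: group_true_def)

lemma group_true_remove:
  "group_true M p g \<longleftrightarrow> i \<in> g \<and> formula_true M (p ! i) \<or> group_true M p (g - {i})"
  unfolding group_true_def by blast

lemma group_true_image:
  assumes "\<And>i. i \<in> g \<Longrightarrow> p ! f i = q ! i"
  shows "group_true M p (f ` g) \<longleftrightarrow> group_true M q g"
  using assms by (auto simp: group_true_def)

lemma group_true_append_left:
  "g \<subseteq> {..<length p} \<Longrightarrow> group_true M (p @ q) g \<longleftrightarrow> group_true M p g"
  by (auto simp: group_true_def nth_append subset_iff)

lemma nth_transpose:
  "(xs @ [y, x] @ ys) ! transpose (length xs) (Suc (length xs)) i = (xs @ [x, y] @ ys) ! i"
  by (auto simp: transpose_def nth_append nth_Cons split: nat.splits)

lemma nth_open_gap: "(xs @ [x] @ ys) ! open_gap (length xs) i = (xs @ ys) ! i"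
  by (auto simp: open_gap_def nth_append Suc_diff_le)

lemma nth_collapse:
  assumes "i \<noteq> length xs" "i \<noteq> Suc (length xs)"
  shows "(xs @ [z] @ ys) ! collapse (length xs) i = (xs @ [x, y] @ ys) ! i"
proof (cases "Suc (length xs) < i")
  case True
  then obtain k where "i = length xs + Suc (Suc k)"
    by (metis add_Suc_right less_iff_Suc_add add_Suc)
  then show ?thesis
    by (simp add: collapse_def nth_append)
qed (use assms in \<open>auto simp: collapse_def nth_append\<close>)

lemma surj_collapse [simp]: "surj (collapse n)"
proof (rule surjI)
  show "collapse n (if i \<le> n then i else Suc i) = i" for i
    by (simp add: collapse_def)
qed

lemma collapse_self [simp]: "collapse n n = n" "collapse n (Suc n) = n"
  by (simp_all add: collapse_def)

lemma collapse_eq_iff: "collapse n i = n \<longleftrightarrow> i = n \<or> i = Suc n"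
  by (auto simp: collapse_def)

lemma collapse_less_iff: "n < m \<Longrightarrow> collapse n i < m \<longleftrightarrow> i < Suc m"
  by (auto simp: collapse_def)

lemma group_true_adjacent:
  "group_true M (p @ [F, G] @ q) g \<longleftrightarrow>
     length p \<in> g \<and> formula_true M F \<or> Suc (length p) \<in> g \<and> formula_true M G \<or>
     group_true M (p @ [F, G] @ q) (g - {length p, Suc (length p)})"
  unfolding group_true_remove[of M _ g "length p"]
    group_true_remove[of M _ "g - {length p}" "Suc (length p)"]
  by (simp add: nth_append Diff_insert2[of g _ "{Suc (length p)}"])

lemma group_true_collapse:
  "group_true M (p @ [H] @ q) g \<longleftrightarrow>
     length p \<in> g \<and> formula_true M H \<or>
     group_true M (p @ [F, G] @ q) (collapse (length p) -` g - {length p, Suc (length p)})"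
proof -
  let ?n = "length p" and ?h = "collapse (length p) -` g"
  have "g - {?n} = collapse ?n ` (?h - {?n, Suc ?n})"
  proof -
    have "?h - {?n, Suc ?n} = collapse ?n -` (g - {?n})"
      by (auto simp: collapse_eq_iff)
    then show ?thesis
      by (simp only: surj_image_vimage_eq[OF surj_collapse])
  qed
  then have "group_true M (p @ [H] @ q) (g - {?n}) \<longleftrightarrow>
      group_true M (p @ [F, G] @ q) (?h - {?n, Suc ?n})"
    by (simp only:) (rule group_true_image, rule nth_collapse, auto)
  then show ?thesis
    unfolding group_true_remove[of M "p @ [H] @ q" g ?n] by simp
qed

lemma group_true_Or:
  "group_true M (p @ [Or F G] @ q) g \<longleftrightarrow>
     group_true M (p @ [F, G] @ q) (collapse (length p) -` g)"
  unfolding group_true_collapse[of M p _ q g F G]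
    group_true_adjacent[of M p F G q "collapse (length p) -` g"]
  by auto

lemma group_true_And:
  "group_true M (p @ [And F G] @ q) g \<longleftrightarrow>
     group_true M (p @ [F, G] @ q) (collapse (length p) -` g - {Suc (length p)}) \<and>
     group_true M (p @ [F, G] @ q) (collapse (length p) -` g - {length p})"
proof -
  let ?n = "length p" and ?h = "collapse (length p) -` g"
  have "?h - {Suc ?n} - {?n, Suc ?n} = ?h - {?n, Suc ?n}"
    and "?h - {?n} - {?n, Suc ?n} = ?h - {?n, Suc ?n}"
    by auto
  then show ?thesis
    unfolding group_true_collapse[of M p _ q g F G]
      group_true_adjacent[of M p F G q "?h - {Suc ?n}"]
      group_true_adjacent[of M p F G q "?h - {?n}"]
    by auto
qed

section \<open>Merging and splitting groups\<close>

lemma and_ready_appendI: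
  assumes "and_ready n s" "and_ready n t"
  shows "and_ready n (s @ t)"
  unfolding and_ready_def
proof (intro allI impI)
  fix j assume j: "j < length (s @ t)"
  show "\<not> (n \<in> (s @ t) ! j \<and> Suc n \<in> (s @ t) ! j) \<and>
      (n \<in> (s @ t) ! j \<longrightarrow> Suc j < length (s @ t) \<and> Suc n \<in> (s @ t) ! Suc j) \<and>
      (Suc n \<in> (s @ t) ! j \<longrightarrow> 0 < j \<and> n \<in> (s @ t) ! (j - 1))"
  proof (cases "j < length s")
    case True
    then show ?thesis
      using assms(1)[unfolded and_ready_def, rule_format, of j] by (auto simp: nth_append)
  next
    case False
    then obtain k where "j = length s + k"
      using le_Suc_ex not_less by blast
    then show ?thesis
      using assms(2)[unfolded and_ready_def, rule_format, of k] j
      by (cases k) (auto simp: nth_append)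
  qed
qed

lemma and_ready_append_rightD:
  assumes "and_ready n (s @ t)" "and_ready n s"
  shows "and_ready n t"
  unfolding and_ready_def
proof (intro allI impI)
  fix j assume "j < length t"
  moreover have "Suc n \<notin> t ! 0" if "0 < length t"
  proof
    assume "Suc n \<in> t ! 0"
    with assms(1)[unfolded and_ready_def, rule_format, of "length s"] that
    have "0 < length s" "n \<in> s ! (length s - 1)"
      by (auto simp: nth_append)
    with assms(2)[unfolded and_ready_def, rule_format, of "length s - 1"] show False
      by auto
  qed
  ultimately show "\<not> (n \<in> t ! j \<and> Suc n \<in> t ! j) \<and>
      (n \<in> t ! j \<longrightarrow> Suc j < length t \<and> Suc n \<in> t ! Suc j) \<and>
      (Suc n \<in> t ! j \<longrightarrow> 0 < j \<and> n \<in> t ! (j - 1))"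
    using assms(1)[unfolded and_ready_def, rule_format, of "length s + j"]
    by (cases j) (auto simp: nth_append)
qed

lemma and_ready_Nil: "and_ready n []"
  by (simp add: and_ready_def)

lemma and_ready_singleton: "and_ready n [g] \<longleftrightarrow> n \<notin> g \<and> Suc n \<notin> g"
  by (auto simp: and_ready_def)

lemma and_ready_pair:
  "n \<in> g \<Longrightarrow> and_ready n [g, h] \<longleftrightarrow> Suc n \<notin> g \<and> n \<notin> h \<and> Suc n \<in> h"
  by (auto simp: and_ready_def less_Suc_eq)

lemma and_ready_Cons:
  assumes "n \<notin> g"
  shows "and_ready n (g # s) \<longleftrightarrow> Suc n \<notin> g \<and> and_ready n s"
proof (cases "Suc n \<in> g")
  case True
  then have "\<not> and_ready n (g # s)"
    by (auto simp: and_ready_def)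
  with True show ?thesis
    by simp
next
  case False
  then show ?thesis
    using assms and_ready_appendI[of n "[g]" s] and_ready_append_rightD[of n "[g]" s]
    by (auto simp: and_ready_singleton)
qed

lemma and_ready_Cons_Cons:
  assumes "n \<in> g"
  shows "and_ready n (g # h # s) \<longleftrightarrow> Suc n \<notin> g \<and> n \<notin> h \<and> Suc n \<in> h \<and> and_ready n s"
proof (cases "Suc n \<notin> g \<and> n \<notin> h \<and> Suc n \<in> h")
  case True
  then show ?thesis
    using assms and_ready_appendI[of n "[g, h]" s] and_ready_append_rightD[of n "[g, h]" s]
    by (auto simp: and_ready_pair)
next
  case False
  have "\<not> and_ready n (g # h # s)"
  proof
    assume "and_ready n (g # h # s)"
    from this[unfolded and_ready_def, rule_format, of 0]
      this[unfolded and_ready_def, rule_format, of 1]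
    show False
      using assms False by auto
  qed
  with False show ?thesis
    by blast
qed

lemma merge_groups_Cons: "n \<notin> g \<Longrightarrow> merge_groups n (g # s) = g # merge_groups n s"
  by (cases s) auto

lemma in_set_merge_groups_cases:
  assumes "and_ready n s" "k \<in> set (merge_groups n s)"
  obtains (unmerged) "k \<in> set s" "n \<notin> k" "Suc n \<notin> k"
  | (merged) g h where "g \<in> set s" "h \<in> set s" "k = g \<union> h" "Suc n \<notin> g" "n \<notin> h"
proof -
  have "k \<in> A \<and> n \<notin> k \<and> Suc n \<notin> k \<or>
      (\<exists>g\<in>A. \<exists>h\<in>A. k = g \<union> h \<and> Suc n \<notin> g \<and> n \<notin> h)" if "set s \<subseteq> A" for A
    using assms that
  proof (induction n s rule: merge_groups.induct)
    case (2 n g)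
    then show ?case
      by (auto simp: and_ready_singleton)
  next
    case (3 n g h s)
    show ?case
    proof (cases "n \<in> g")
      case True
      with "3.prems" have "Suc n \<notin> g" "n \<notin> h" "and_ready n s" "g \<in> A" "h \<in> A" "set s \<subseteq> A"
        and "k = g \<union> h \<or> k \<in> set (merge_groups n s)"
        by (simp_all add: and_ready_Cons_Cons)
      with "3.IH"(1)[OF True] show ?thesis
        by blast
    next
      case False
      with "3.prems" have "Suc n \<notin> g" "and_ready n (h # s)" "g \<in> A" "set (h # s) \<subseteq> A"
        and "k = g \<or> k \<in> set (merge_groups n (h # s))"
        by (simp_all add: and_ready_Cons)
      with "3.IH"(2)[OF False] False show ?thesis
        by blast
    qed
  qed simp
  from this[OF order_refl] that show ?thesis
    by blast
qed

definition split_group :: "nat \<Rightarrow> nat set \<Rightarrow> nat set list" where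
  "split_group n g =
     (let h = collapse n -` g in if n \<in> g then [h - {Suc n}, h - {n}] else [h])"

lemma and_ready_split_groups: "and_ready n (concat (map (split_group n) s))"
proof (induction s)
  case (Cons g s)
  then show ?case
    by (auto simp: split_group_def Let_def and_ready_Cons and_ready_Cons_Cons)
qed (simp add: and_ready_Nil)

lemma merge_split_groups:
  "map (image (collapse n)) (merge_groups n (concat (map (split_group n) s))) = s"
proof (induction s)
  case (Cons g s)
  have "collapse n -` g - {Suc n} \<union> (collapse n -` g - {n}) = collapse n -` g"
    by auto
  with Cons show ?case
    by (simp add: split_group_def Let_def merge_groups_Cons)
qed simp

section \<open>Soundness\<close>

lemma is_cirquent_Pair [simp]: "is_cirquent (p, s) \<longleftrightarrow> (\<forall>g\<in>set s. g \<subseteq> {..<length p})"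
  by (simp add: is_cirquent_def)

lemma CL5_is_cirquent: "CL5 C \<Longrightarrow> is_cirquent C"
proof (induction rule: CL5.induct)
  case (oformula_exchange p F G q s)
  then show ?case
    by (fastforce simp: transpose_def)
next
  case (pool_weakening p q s F)
  then show ?case
    by (fastforce simp: open_gap_def)
next
  case (or_introduction p F G q s)
  then show ?case
    by (fastforce simp: collapse_less_iff)
next
  case (and_introduction p F G q s)
  have "k \<subseteq> {..<length (p @ [F, G] @ q)}" if "k \<in> set (merge_groups (length p) s)" for k
    using and_introduction.hyps(2) that
    by (rule in_set_merge_groups_cases) (use and_introduction.IH in auto)
  then show ?case
    by (fastforce simp: collapse_less_iff)
qed fastforce+

lemma group_true_And_merged:
  assumes "and_ready (length p) s" "k \<in> set (merge_groups (length p) s)"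
    and s: "\<forall>g\<in>set s. group_true M (p @ [F, G] @ q) g"
  shows "group_true M (p @ [And F G] @ q) (collapse (length p) ` k)"
  using assms(1,2)
proof (cases rule: in_set_merge_groups_cases)
  case unmerged
  then have "k \<subseteq> collapse (length p) -` (collapse (length p) ` k) - {Suc (length p)}"
    and "k \<subseteq> collapse (length p) -` (collapse (length p) ` k) - {length p}"
    by auto
  then show ?thesis
    unfolding group_true_And using s unmerged by (blast intro: group_true_mono)
next
  case (merged g h)
  then have "g \<subseteq> collapse (length p) -` (collapse (length p) ` k) - {Suc (length p)}"
    and "h \<subseteq> collapse (length p) -` (collapse (length p) ` k) - {length p}"
    by auto
  then show ?thesis
    unfolding group_true_And using s merged by (blast intro: group_true_mono)
qed

lemma CL5_cirquent_true: "CL5 C \<Longrightarrow> cirquent_true M C"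
proof (induction rule: CL5.induct)
  case (mix p s q t)
  have "group_true M (p @ q) g" if "g \<in> set s" for g
    using mix.IH(1) CL5_is_cirquent[OF mix.hyps(1)] that by (simp add: group_true_append_left)
  moreover have "group_true M (p @ q) ((\<lambda>i. length p + i) ` g)" if "g \<in> set t" for g
    using mix.IH(2) that by (simp add: group_true_image)
  ultimately show ?case
    by auto
next
  case (oformula_exchange p F G q s)
  then show ?case
    by (simp add: group_true_image[OF nth_transpose, simplified])
next
  case (ogroup_weakening p s g t i)
  then show ?case
    by (auto intro: group_true_mono)
next
  case (pool_weakening p q s F)
  then show ?case
    by (simp add: group_true_image[OF nth_open_gap, simplified])
next
  case (or_introduction p F G q s)
  have "group_true M (p @ [Or F G] @ q) (collapse (length p) ` g)" if "g \<in> set s" for g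
    unfolding group_true_Or using or_introduction.IH that by (auto intro: group_true_mono)
  then show ?case
    by simp
next
  case (and_introduction p F G q s)
  then show ?case
    using group_true_And_merged[of p s _ M F G q] by simp
qed (auto simp: group_true_def)

theorem CL5_sound: "CL5 C \<Longrightarrow> tautology C"
  by (simp add: tautology_def CL5_cirquent_true)

section \<open>Provable cirquents as instances of binary ones\<close>

lemma neg_neg [simp]: "neg (neg F) = F"
  by (induction F) auto

lemma formula_subst_neg: "formula_subst \<sigma> (neg F) = neg (formula_subst \<sigma> F)"
  by (induction F) auto

lemma formula_subst_cong:
  "(\<And>P. P \<in> set_formula F \<Longrightarrow> \<sigma> P = \<tau> P) \<Longrightarrow> formula_subst \<sigma> F = formula_subst \<tau> F"
  by (induction F) auto

lemma formula_occs_eq_0_iff: "formula_occs P F = 0 \<longleftrightarrow> P \<notin> set_formula F"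
  by (induction F) auto

definition cirquent_atoms :: "'a cirquent \<Rightarrow> 'a set" where
  "cirquent_atoms C = \<Union> (set_formula ` set (fst C))"

lemma finite_cirquent_atoms [simp]: "finite (cirquent_atoms C)"
proof -
  have "finite (set_formula F)" for F :: "'a formula"
    by (induction F) auto
  then show ?thesis
    by (simp add: cirquent_atoms_def)
qed

lemma cirquent_occs_eq_0_iff: "cirquent_occs P C = 0 \<longleftrightarrow> P \<notin> cirquent_atoms C"
  by (auto simp: cirquent_occs_def cirquent_atoms_def formula_occs_eq_0_iff)

lemma map_formula_subst_cong:
  assumes "\<And>P. P \<in> cirquent_atoms (p, s) \<Longrightarrow> \<sigma> P = \<tau> P"
  shows "map (formula_subst \<sigma>) p = map (formula_subst \<tau>) p"
  using assms by (auto simp: cirquent_atoms_def intro!: formula_subst_cong)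

lemma binary_append:
  assumes "binary (p, s)" "binary (q, t)" "cirquent_atoms (p, s) \<inter> cirquent_atoms (q, t) = {}"
  shows "binary (p @ q, u)"
  unfolding binary_def
proof
  fix P
  have "cirquent_occs P (p @ q, u) = cirquent_occs P (p, s) + cirquent_occs P (q, t)"
    by (simp add: cirquent_occs_def)
  moreover have "cirquent_occs P (p, s) = 0 \<or> cirquent_occs P (q, t) = 0"
    using assms(3) by (auto simp: cirquent_occs_eq_0_iff)
  ultimately show "cirquent_occs P (p @ q, u) \<le> 2"
    using assms(1,2) by (auto simp: binary_def)
qed

text \<open>Avoiding an arbitrary finite set \<open>X\<close> of atoms is what makes the two premises of mix
  combinable.\<close>

definition has_binary_source :: "'a set \<Rightarrow> 'a cirquent \<Rightarrow> bool" where
  "has_binary_source X C \<longleftrightarrow>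
     (\<exists>A. CL5 A \<and> binary A \<and> cirquent_atoms A \<inter> X = {} \<and> instance_of C A)"

lemma has_binary_sourceI:
  assumes "CL5 (p, s)" "binary (p, s)" "cirquent_atoms (p, s) \<inter> X = {}"
    and "map (formula_subst \<sigma>) p = q"
  shows "has_binary_source X (q, s)"
  unfolding has_binary_source_def instance_of_def
  using assms by (intro exI[of _ "(p, s)"] conjI exI[of _ \<sigma>]) (simp_all add: cirquent_subst_def)

lemma has_binary_sourceE:
  assumes "has_binary_source X (q, s)"
  obtains p \<sigma> where "CL5 (p, s)" "binary (p, s)" "cirquent_atoms (p, s) \<inter> X = {}"
    and "q = map (formula_subst \<sigma>) p"
  using assms by (auto simp: has_binary_source_def instance_of_def cirquent_subst_def)

lemma has_binary_source_change_groups: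
  fixes p :: "'a formula list"
  assumes "has_binary_source X (p, s)"
    and "\<And>p' :: 'a formula list. length p' = length p \<Longrightarrow> CL5 (p', s) \<Longrightarrow> CL5 (p', t)"
  shows "has_binary_source X (p, t)"
  using assms(1)
proof (rule has_binary_sourceE)
  fix p' \<sigma>
  assume "CL5 (p', s)" "binary (p', s)" "cirquent_atoms (p', s) \<inter> X = {}"
    and "p = map (formula_subst \<sigma>) p'"
  with assms(2)[of p'] show ?thesis
    by (intro has_binary_sourceI[of p' t])
      (auto simp: binary_def cirquent_occs_def cirquent_atoms_def)
qed

lemma has_binary_source_rewrite_adjacent:
  fixes p :: "'a formula list" and k :: "'a formula \<Rightarrow> 'a formula \<Rightarrow> 'a formula list"
  assumes "has_binary_source X (p @ [F, G] @ q, s)"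
    and rule: "\<And>p' F G q'. length p' = length p \<Longrightarrow> CL5 (p' @ [F, G] @ q', s) \<Longrightarrow>
      CL5 (p' @ k F G @ q', t)"
    and subst: "\<And>\<sigma> F G. map (formula_subst \<sigma>) (k F G) = k (formula_subst \<sigma> F) (formula_subst \<sigma> G)"
    and occs: "\<And>P F G. (\<Sum>H\<leftarrow>k F G. formula_occs P H) = formula_occs P F + formula_occs P G"
  shows "has_binary_source X (p @ k F G @ q, t)"
  using assms(1)
proof (rule has_binary_sourceE)
  fix r \<sigma>
  assume r: "CL5 (r, s)" "binary (r, s)" "cirquent_atoms (r, s) \<inter> X = {}"
    and "p @ [F, G] @ q = map (formula_subst \<sigma>) r"
  then obtain p' F' G' q' where parts: "r = p' @ [F', G'] @ q'"
      "p = map (formula_subst \<sigma>) p'" "F = formula_subst \<sigma> F'" "G = formula_subst \<sigma> G'"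
      "q = map (formula_subst \<sigma>) q'"
    by (auto simp: append_eq_map_conv Cons_eq_map_conv)
  have occs_eq: "cirquent_occs P (p' @ k F' G' @ q', t) = cirquent_occs P (r, s)" for P
    by (simp add: cirquent_occs_def parts(1) occs)
  then have "cirquent_atoms (p' @ k F' G' @ q', t) = cirquent_atoms (r, s)"
    using cirquent_occs_eq_0_iff by (metis subsetI subset_antisym)
  with occs_eq r show ?thesis
    by (intro has_binary_sourceI[of "p' @ k F' G' @ q'" t _ \<sigma>] rule)
      (auto simp: parts subst binary_def)
qed

lemma has_binary_source_empty: "has_binary_source X ([], [])"
  by (rule has_binary_sourceI[of "[]"])
    (simp_all add: CL5.empty_axiom binary_def cirquent_occs_def cirquent_atoms_def)

lemma has_binary_source_identity:
  assumes "P \<notin> X"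
  shows "has_binary_source X ([neg F, F], [{0, 1}])"
proof (rule has_binary_sourceI)
  show "CL5 ([neg (Atom P), Atom P], [{0, 1}])"
    by (rule CL5.identity_axiom)
  show "map (formula_subst (\<lambda>_. F)) [neg (Atom P), Atom P] = [neg F, F]"
    by simp
qed (use assms in \<open>auto simp: binary_def cirquent_occs_def cirquent_atoms_def\<close>)

lemma has_binary_source_mix:
  fixes p q :: "'a formula list"
  assumes source_p: "\<And>X. finite X \<Longrightarrow> has_binary_source X (p, s)"
    and source_q: "\<And>X. finite X \<Longrightarrow> has_binary_source X (q, t)"
    and "finite X"
  shows "has_binary_source X (p @ q, s @ map (image (\<lambda>i. length p + i)) t)"
proof -
  obtain p' \<sigma> where p': "CL5 (p', s)" "binary (p', s)" "cirquent_atoms (p', s) \<inter> X = {}"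
      "p = map (formula_subst \<sigma>) p'"
    using source_p[OF \<open>finite X\<close>] by (rule has_binary_sourceE)
  have "finite (X \<union> cirquent_atoms (p', s))"
    using \<open>finite X\<close> by simp
  from source_q[OF this] obtain q' \<tau> where q': "CL5 (q', t)" "binary (q', t)"
      "cirquent_atoms (q', t) \<inter> (X \<union> cirquent_atoms (p', s)) = {}"
      "q = map (formula_subst \<tau>) q'"
    by (rule has_binary_sourceE)
  let ?\<rho> = "override_on \<tau> \<sigma> (cirquent_atoms (p', s))"
  show ?thesis
  proof (rule has_binary_sourceI)
    show "CL5 (p' @ q', s @ map (image (\<lambda>i. length p + i)) t)"
      using CL5.mix[OF p'(1) q'(1)] p'(4) by simp
    show "binary (p' @ q', s @ map (image (\<lambda>i. length p + i)) t)"
      using p'(2) q'(2,3) by (intro binary_append[of p' s q' t]) auto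
    show "cirquent_atoms (p' @ q', s @ map (image (\<lambda>i. length p + i)) t) \<inter> X = {}"
      using p'(3) q'(3) by (auto simp: cirquent_atoms_def)
    have "map (formula_subst ?\<rho>) p' = p"
      unfolding p'(4) by (rule map_formula_subst_cong[of _ s]) simp
    moreover have "map (formula_subst ?\<rho>) q' = q"
      unfolding q'(4) using q'(3)
      by (intro map_formula_subst_cong[of _ t] override_on_apply_notin) auto
    ultimately show "map (formula_subst ?\<rho>) (p' @ q') = p @ q"
      by simp
  qed
qed

lemma has_binary_source_pool_weakening:
  fixes p q :: "'a formula list"
  assumes "infinite (UNIV :: 'a set)" "finite X" "has_binary_source X (p @ q, s)"
  shows "has_binary_source X (p @ [F] @ q, map (image (open_gap (length p))) s)"
  using assms(3)
proof (rule has_binary_sourceE)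
  fix r \<sigma>
  assume r: "CL5 (r, s)" "binary (r, s)" "cirquent_atoms (r, s) \<inter> X = {}"
    and "p @ q = map (formula_subst \<sigma>) r"
  then obtain p' q' where parts: "r = p' @ q'" "p = map (formula_subst \<sigma>) p'"
      "q = map (formula_subst \<sigma>) q'"
    by (auto simp: append_eq_map_conv)
  have "finite (X \<union> cirquent_atoms (r, s))"
    using \<open>finite X\<close> by simp
  from ex_new_if_finite[OF assms(1) this] obtain P where P: "P \<notin> X" "P \<notin> cirquent_atoms (r, s)"
    by auto
  show ?thesis
  proof (rule has_binary_sourceI)
    show "CL5 (p' @ [Atom P] @ q', map (image (open_gap (length p))) s)"
      using r(1) CL5.pool_weakening[of p' q' s "Atom P"] by (simp add: parts)
    have "cirquent_occs Q (p' @ [Atom P] @ q', t) = (if Q = P then 1 else cirquent_occs Q (r, s))"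
      for Q t
      using P(2) by (auto simp: cirquent_occs_eq_0_iff[symmetric] cirquent_occs_def parts(1))
    then show "binary (p' @ [Atom P] @ q', map (image (open_gap (length p))) s)"
      using r(2) by (simp add: binary_def)
    show "cirquent_atoms (p' @ [Atom P] @ q', map (image (open_gap (length p))) s) \<inter> X = {}"
      using r(3) P(1) by (auto simp: cirquent_atoms_def parts(1))
    have "map (formula_subst (\<sigma>(P := F))) r = map (formula_subst \<sigma>) r"
      using P(2) by (intro map_formula_subst_cong[of _ s]) auto
    then show "map (formula_subst (\<sigma>(P := F))) (p' @ [Atom P] @ q') = p @ [F] @ q"
      by (simp add: parts)
  qed
qed

theorem CL5_has_binary_source:
  fixes C :: "'a cirquent"
  assumes "infinite (UNIV :: 'a set)" "CL5 C" "finite X"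
  shows "has_binary_source X C"
  using assms(2,3)
proof (induction arbitrary: X rule: CL5.induct)
  case (identity_axiom F)
  obtain P where "P \<notin> X"
    using ex_new_if_finite[OF assms(1) \<open>finite X\<close>] by auto
  then show ?case
    by (rule has_binary_source_identity)
next
  case (mix p s q t)
  then show ?case
    by (intro has_binary_source_mix)
next
  case (oformula_exchange p F G q s)
  show ?case
    by (rule has_binary_source_rewrite_adjacent[OF oformula_exchange.IH[OF \<open>finite X\<close>],
          where k = "\<lambda>F G. [G, F]"])
      (use CL5.oformula_exchange in metis, simp_all)
next
  case (ogroup_weakening p s g t i)
  then show ?case
    by (metis CL5.ogroup_weakening has_binary_source_change_groups)
next
  case (pool_weakening p q s F)
  then show ?case
    using has_binary_source_pool_weakening[OF assms(1)] by blast
next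
  case (or_introduction p F G q s)
  show ?case
    by (rule has_binary_source_rewrite_adjacent[OF or_introduction.IH[OF \<open>finite X\<close>],
          where k = "\<lambda>F G. [Or F G]"])
      (use CL5.or_introduction in metis, simp_all)
next
  case (and_introduction p F G q s)
  show ?case
    by (rule has_binary_source_rewrite_adjacent[OF and_introduction.IH[OF \<open>finite X\<close>],
          where k = "\<lambda>F G. [And F G]"])
      (use and_introduction.hyps(2) CL5.and_introduction in metis, simp_all)
qed (auto intro: has_binary_source_empty has_binary_source_change_groups
    CL5.ogroup_exchange[simplified] CL5.duplication_down[simplified] CL5.duplication_up[simplified])

section \<open>Derived structural rules\<close>

lemma adjacent_swap_induct [consumes 1, case_names base swap]:
  assumes "mset xs = mset ys" "P xs"
    and swap: "\<And>us x y vs. P (us @ [x, y] @ vs) \<Longrightarrow> P (us @ [y, x] @ vs)"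
  shows "P ys"
proof -
  have shift: "P (zs @ us @ [x] @ vs) \<Longrightarrow> P (zs @ [x] @ us @ vs)" for zs us x vs
  proof (induction us arbitrary: vs rule: rev_induct)
    case (snoc u us)
    then show ?case
      using swap[of "zs @ us" u x vs] by simp
  qed simp
  have "mset xs = mset ys \<Longrightarrow> P (zs @ xs) \<Longrightarrow> P (zs @ ys)" for zs
  proof (induction ys arbitrary: xs zs)
    case (Cons y ys)
    then obtain us vs where xs: "xs = us @ [y] @ vs"
      by (metis append_Cons append_Nil list.set_intros(1) set_mset_mset split_list)
    then have "P ((zs @ [y]) @ us @ vs)"
      using Cons.prems(2) shift[of zs us y vs] by simp
    moreover have "mset (us @ vs) = mset ys"
      using Cons.prems(1) xs by simp
    ultimately show ?case
      using Cons.IH[of "us @ vs" "zs @ [y]"] by simp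
  qed simp
  from this[of "[]"] show ?thesis
    using assms by simp
qed

lemma CL5_mset_groups:
  assumes "mset s = mset t" "CL5 (p, s)"
  shows "CL5 (p, t)"
  using assms by (induction rule: adjacent_swap_induct) (blast intro: CL5.ogroup_exchange)+

lemma CL5_repeated_group:
  assumes "g \<in> set s"
  shows "CL5 (p, u @ g # s) \<longleftrightarrow> CL5 (p, u @ s)"
proof -
  obtain a b where s: "s = a @ g # b"
    using assms by (meson split_list)
  have "CL5 (p, u @ g # s) \<longleftrightarrow> CL5 (p, [] @ [g, g] @ u @ a @ b)"
    using s by (auto elim!: CL5_mset_groups[rotated])
  also have "\<dots> \<longleftrightarrow> CL5 (p, [] @ [g] @ u @ a @ b)"
    using CL5.duplication_down CL5.duplication_up by blast
  also have "\<dots> \<longleftrightarrow> CL5 (p, u @ s)"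
    using s by (auto elim!: CL5_mset_groups[rotated])
  finally show ?thesis .
qed

lemma CL5_remdups_groups: "CL5 (p, u @ remdups s) \<longleftrightarrow> CL5 (p, u @ s)"
proof (induction s arbitrary: u)
  case (Cons g s)
  show ?case
    using Cons[of "u @ [g]"] Cons[of u] CL5_repeated_group[of g s p u] by auto
qed simp

lemma CL5_set_groups:
  assumes "set s = set t" "CL5 (p, s)"
  shows "CL5 (p, t)"
  using assms CL5_remdups_groups[of p "[]"] CL5_mset_groups set_eq_iff_mset_remdups_eq
  by (metis append_Nil)

lemma CL5_weaken_group:
  assumes "CL5 (p, s @ g # t)" "g \<subseteq> h" "h \<subseteq> {..<length p}"
  shows "CL5 (p, s @ h # t)"
proof -
  have "finite h"
    using assms(3) finite_subset by blast
  then have "CL5 (p, s @ (h \<union> g) # t)"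
    using assms(3)
  proof (induction h rule: finite_induct)
    case (insert i h)
    then show ?case
      using CL5.ogroup_weakening[of p s "h \<union> g" t i] by simp
  qed (use assms(1) in simp)
  then show ?thesis
    using assms(2) by (simp add: Un_absorb2)
qed

lemma CL5_weaken_groups:
  assumes "list_all2 (\<subseteq>) t s" "is_cirquent (p, s)" "CL5 (p, u @ t)"
  shows "CL5 (p, u @ s)"
  using assms
proof (induction arbitrary: u rule: list_all2_induct)
  case (Cons h t g s)
  then have "CL5 (p, (u @ [g]) @ t)"
    using CL5_weaken_group[of p u h t g] by simp
  from Cons.IH[OF _ this] show ?case
    using Cons.prems by simp
qed simp

text \<open>Groups as sets of labels rather than of positions: permuting the pool then leaves them
  unchanged.\<close>

definition positions :: "'b list \<Rightarrow> 'b set \<Rightarrow> nat set" where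
  "positions xs g = {i. i < length xs \<and> xs ! i \<in> g}"

definition labelled :: "('b \<Rightarrow> 'a formula) \<Rightarrow> 'b list \<Rightarrow> 'b set list \<Rightarrow> 'a cirquent" where
  "labelled \<phi> xs s = (map \<phi> xs, map (positions xs) s)"

lemma positions_append:
  "positions (xs @ ys) g = positions xs g \<union> (\<lambda>i. length xs + i) ` positions ys g"
proof (intro set_eqI iffI)
  fix i assume i: "i \<in> positions (xs @ ys) g"
  show "i \<in> positions xs g \<union> (\<lambda>i. length xs + i) ` positions ys g"
  proof (cases "i < length xs")
    case False
    then have "i = length xs + (i - length xs)" "i - length xs \<in> positions ys g"
      using i by (auto simp: positions_def nth_append)
    then show ?thesis by blast
  qed (use i in \<open>auto simp: positions_def nth_append\<close>)
qed (auto simp: positions_def nth_append)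

lemma positions_disjoint: "g \<inter> set xs = {} \<Longrightarrow> positions xs g = {}"
  by (auto simp: positions_def)

lemma positions_upt: "g \<subseteq> {..<n} \<Longrightarrow> positions [0..<n] g = g"
  by (auto simp: positions_def)

lemma positions_swap:
  "positions (xs @ [y, x] @ ys) g =
     transpose (length xs) (Suc (length xs)) ` positions (xs @ [x, y] @ ys) g"
proof -
  let ?\<tau> = "transpose (length xs) (Suc (length xs))"
  have "?\<tau> i < length (xs @ [x, y] @ ys) \<longleftrightarrow> i < length (xs @ [y, x] @ ys)" for i
    by (auto simp: transpose_def)
  then show ?thesis
    by (simp only: set_eq_iff in_transpose_image_iff positions_def mem_Collect_eq nth_transpose
        simp_thms)
qed

lemma CL5_labelled_mset:
  assumes "mset xs = mset ys" "CL5 (labelled \<phi> xs s)"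
  shows "CL5 (labelled \<phi> ys s)"
  using assms
proof (induction rule: adjacent_swap_induct)
  case (swap us x y vs)
  then have "CL5 (map \<phi> us @ [\<phi> x, \<phi> y] @ map \<phi> vs, map (positions (us @ [x, y] @ vs)) s)"
    by (simp add: labelled_def)
  from CL5.oformula_exchange[OF this] show ?case
    by (simp add: labelled_def positions_swap[of us y x, simplified, symmetric] comp_def)
qed

lemma CL5_labelled_mix:
  assumes "CL5 (labelled \<phi> xs s)" "CL5 (labelled \<phi> ys t)" "set xs \<inter> set ys = {}"
    and "\<And>g. g \<in> set s \<Longrightarrow> g \<subseteq> set xs" "\<And>g. g \<in> set t \<Longrightarrow> g \<subseteq> set ys"
  shows "CL5 (labelled \<phi> (xs @ ys) (s @ t))"
proof -
  have "positions (xs @ ys) g = positions xs g" if "g \<in> set s" for g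
    using assms(3) assms(4)[OF that] positions_disjoint[of g ys]
    by (auto simp: positions_append)
  moreover have "positions (xs @ ys) g = (\<lambda>i. length xs + i) ` positions ys g" if "g \<in> set t" for g
    using assms(3) assms(5)[OF that] positions_disjoint[of g xs]
    by (auto simp: positions_append)
  ultimately show ?thesis
    using CL5.mix[OF assms(1,2)[unfolded labelled_def]]
    by (simp add: labelled_def comp_def cong: map_cong)
qed

lemma CL5_append_pool: "CL5 (p, s) \<Longrightarrow> CL5 (p @ q, s)"
proof (induction q rule: rev_induct)
  case (snoc F q)
  then have "CL5 (p @ q, s)"
    by simp
  then have "open_gap (length (p @ q)) ` g = g" if "g \<in> set s" for g
    using CL5_is_cirquent that by (force simp: open_gap_def)
  then show ?case
    using CL5.pool_weakening[of "p @ q" "[]" s F] snoc by (simp add: map_idI)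
qed simp

lemma CL5_labelled_append:
  assumes "CL5 (labelled \<phi> xs s)" "\<And>g. g \<in> set s \<Longrightarrow> g \<inter> set ys = {}"
  shows "CL5 (labelled \<phi> (xs @ ys) s)"
proof -
  have "map (positions (xs @ ys)) s = map (positions xs) s"
    using assms(2) by (simp add: positions_append positions_disjoint)
  with CL5_append_pool[OF assms(1)[unfolded labelled_def], of "map \<phi> ys"] show ?thesis
    by (simp only: labelled_def map_append)
qed

section \<open>Binary tautologies of literals\<close>

definition endpoints :: "('b \<times> 'b) list \<Rightarrow> 'b list" where
  "endpoints ps = concat (map (\<lambda>(x, y). [x, y]) ps)"

lemma endpoints_simps [simp]:
  "endpoints [] = []"
  "endpoints ((x, y) # ps) = x # y # endpoints ps"
  by (simp_all add: endpoints_def)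

lemma set_endpoints: "set (endpoints ps) = (\<Union>(x, y)\<in>set ps. {x, y})"
  by (auto simp: endpoints_def)

lemma CL5_labelled_pairs:
  assumes "distinct (endpoints ps)" "\<And>x y. (x, y) \<in> set ps \<Longrightarrow> \<phi> x = neg (\<phi> y)"
  shows "CL5 (labelled \<phi> (endpoints ps) (map (\<lambda>(x, y). {x, y}) ps))"
  using assms
proof (induction ps)
  case Nil
  show ?case
    by (simp add: labelled_def CL5.empty_axiom)
next
  case (Cons a ps)
  obtain x y where a: "a = (x, y)"
    by fastforce
  have "positions [x, y] {x, y} = {0, 1}"
    by (auto simp: positions_def less_Suc_eq)
  then have "CL5 (labelled \<phi> [x, y] [{x, y}])"
    using Cons.prems(2)[of x y] a CL5.identity_axiom[of "\<phi> y"] by (simp add: labelled_def)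
  moreover have "CL5 (labelled \<phi> (endpoints ps) (map (\<lambda>(x, y). {x, y}) ps))"
    using Cons.prems a by (intro Cons.IH) auto
  ultimately have "CL5 (labelled \<phi> ([x, y] @ endpoints ps) ([{x, y}] @ map (\<lambda>(x, y). {x, y}) ps))"
    using Cons.prems(1) a by (intro CL5_labelled_mix) (auto simp: set_endpoints)
  then show ?case
    using a by simp
qed

lemma CL5_disjoint_pairs:
  assumes dist: "distinct (endpoints ps)"
    and pairs: "\<And>i j. (i, j) \<in> set ps \<Longrightarrow> i < length p \<and> j < length p \<and> p ! i = neg (p ! j)"
  shows "CL5 (p, map (\<lambda>(i, j). {i, j}) ps)"
proof -
  let ?xs = "endpoints ps" and ?gs = "map (\<lambda>(i, j). {i, j}) ps"
  let ?ys = "filter (\<lambda>i. i \<notin> set ?xs) [0..<length p]"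
  have "CL5 (labelled ((!) p) (?xs @ ?ys) ?gs)"
    using CL5_labelled_pairs[OF dist] pairs
    by (intro CL5_labelled_append) (auto simp: set_endpoints)
  moreover have "mset (?xs @ ?ys) = mset [0..<length p]"
  proof -
    have "set (?xs @ ?ys) = set [0..<length p]"
      using pairs by (fastforce simp: set_endpoints)
    moreover have "distinct (?xs @ ?ys)"
      using dist by auto
    ultimately show ?thesis
      by (metis distinct_upt set_eq_iff_mset_eq_distinct)
  qed
  ultimately have "CL5 (labelled ((!) p) [0..<length p] ?gs)"
    using CL5_labelled_mset by blast
  moreover have "map (positions [0..<length p]) ?gs = ?gs"
    using pairs by (intro map_idI positions_upt) auto
  ultimately show ?thesis
    by (simp only: labelled_def map_nth)
qed

definition is_literal :: "'a formula \<Rightarrow> bool" where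
  "is_literal F \<longleftrightarrow> (\<exists>P. F = Atom P \<or> F = NegAtom P)"

definition complementary :: "'a formula list \<Rightarrow> nat \<Rightarrow> nat \<Rightarrow> bool" where
  "complementary p i j \<longleftrightarrow>
     i < length p \<and> j < length p \<and> (\<exists>P. p ! i = NegAtom P \<and> p ! j = Atom P)"

lemma valid_literal_group_complementary:
  assumes "\<forall>F\<in>set p. is_literal F" "g \<subseteq> {..<length p}" "\<And>M. group_true M p g"
  obtains i j where "i \<in> g" "j \<in> g" "complementary p i j"
proof -
  \<comment> \<open>Falsifies every literal of \<open>g\<close>, except for positive ones whose negation is in \<open>g\<close>.\<close>
  define M where "M P \<longleftrightarrow> (\<exists>i\<in>g. p ! i = NegAtom P)" for P
  obtain j where j: "j \<in> g" "formula_true M (p ! j)"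
    using assms(3) by (auto simp: group_true_def)
  with assms(1,2) have "is_literal (p ! j)"
    by auto
  with j obtain P where P: "p ! j = Atom P" "M P"
    by (auto simp: is_literal_def M_def)
  then obtain i where "i \<in> g" "p ! i = NegAtom P"
    by (auto simp: M_def)
  with that j(1) P(1) assms(2) show ?thesis
    by (auto simp: complementary_def)
qed

lemma binary_card_occurrences:
  assumes "binary (p, s)"
  shows "card {i. i < length p \<and> P \<in> set_formula (p ! i)} \<le> 2"
proof -
  let ?I = "{i. i < length p \<and> P \<in> set_formula (p ! i)}"
  have "1 \<le> formula_occs P (p ! i)" if "i \<in> ?I" for i
    using that formula_occs_eq_0_iff[of P "p ! i"] by (simp add: Suc_le_eq)
  then have "card ?I \<le> (\<Sum>i\<in>?I. formula_occs P (p ! i))"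
    using sum_bounded_below[of ?I 1 "\<lambda>i. formula_occs P (p ! i)"] by simp
  also have "\<dots> \<le> (\<Sum>i\<in>{0..<length p}. formula_occs P (p ! i))"
    by (intro sum_mono2) auto
  also have "\<dots> = cirquent_occs P (p, s)"
    by (simp add: cirquent_occs_def sum_list_sum_nth)
  also have "\<dots> \<le> 2"
    using assms by (simp add: binary_def)
  finally show ?thesis .
qed

lemma complementary_unique:
  assumes bin: "binary (p, s)" and compl: "complementary p i j" "complementary p i' j'"
    and meet: "{i, j} \<inter> {i', j'} \<noteq> {}"
  shows "(i', j') = (i, j)"
proof -
  from compl meet obtain P where P: "p ! i = NegAtom P" "p ! j = Atom P"
      "p ! i' = NegAtom P" "p ! j' = Atom P"
    by (fastforce simp: complementary_def)
  then have "i \<noteq> j"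
    by auto
  have "{i, j} = {k. k < length p \<and> P \<in> set_formula (p ! k)}"
  proof (rule card_seteq)
    show "{i, j} \<subseteq> {k. k < length p \<and> P \<in> set_formula (p ! k)}"
      using compl P by (auto simp: complementary_def)
    show "card {k. k < length p \<and> P \<in> set_formula (p ! k)} \<le> card {i, j}"
      using binary_card_occurrences[OF bin, of P] \<open>i \<noteq> j\<close> by simp
  qed simp
  then have "i' \<in> {i, j}" "j' \<in> {i, j}"
    using compl(2) P by (auto simp: complementary_def)
  then show ?thesis
    using P by auto
qed

lemma distinct_endpoints_complementary:
  assumes bin: "binary (p, s)" and "distinct ps"
    and compl: "\<And>i j. (i, j) \<in> set ps \<Longrightarrow> complementary p i j"
  shows "distinct (endpoints ps)"
  unfolding endpoints_def
proof (rule distinct_concat)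
  show "distinct (map (\<lambda>(i, j). [i, j]) ps)"
    using \<open>distinct ps\<close> by (auto simp: distinct_map inj_on_def)
next
  fix xs assume "xs \<in> set (map (\<lambda>(i, j). [i, j]) ps)"
  then show "distinct xs"
    using compl by (fastforce simp: complementary_def)
next
  fix xs ys
  assume "xs \<in> set (map (\<lambda>(i, j). [i, j]) ps)" "ys \<in> set (map (\<lambda>(i, j). [i, j]) ps)" "xs \<noteq> ys"
  then obtain i j i' j' where ij: "xs = [i, j]" "ys = [i', j']" "(i', j') \<noteq> (i, j)"
      "complementary p i j" "complementary p i' j'"
    using compl by fastforce
  then have "{i, j} \<inter> {i', j'} = {}"
    using complementary_unique[OF bin] by metis
  with ij(1,2) show "set xs \<inter> set ys = {}"
    by simp
qed

lemma CL5_literals: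
  assumes "\<forall>F\<in>set p. is_literal F" "binary_tautology (p, s)"
  shows "CL5 (p, s)"
proof -
  have cirq: "is_cirquent (p, s)" and bin: "binary (p, s)"
    and taut: "\<And>M g. g \<in> set s \<Longrightarrow> group_true M p g"
    using assms(2) by (simp_all add: binary_tautology_def tautology_def)
  have "\<exists>i j. i \<in> g \<and> j \<in> g \<and> complementary p i j" if "g \<in> set s" for g
    using valid_literal_group_complementary[OF assms(1) _ taut[OF that]] cirq that
    by (metis is_cirquent_Pair)
  then obtain neg_pos pos_pos where pos: "\<And>g. g \<in> set s \<Longrightarrow>
      neg_pos g \<in> g \<and> pos_pos g \<in> g \<and> complementary p (neg_pos g) (pos_pos g)"
    by metis
  define ps where "ps = remdups (map (\<lambda>g. (neg_pos g, pos_pos g)) s)"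
  have compl: "complementary p i j" if "(i, j) \<in> set ps" for i j
    using that pos by (auto simp: ps_def)
  then have "CL5 (p, map (\<lambda>(i, j). {i, j}) ps)"
    by (intro CL5_disjoint_pairs distinct_endpoints_complementary[OF bin])
      (fastforce simp: ps_def complementary_def)+
  then have "CL5 (p, map (\<lambda>g. {neg_pos g, pos_pos g}) s)"
    by (rule CL5_set_groups[rotated]) (auto simp: ps_def)
  moreover have "list_all2 (\<subseteq>) (map (\<lambda>g. {neg_pos g, pos_pos g}) s) s"
    using pos by (simp add: list_all2_map1 list_all2_same)
  ultimately show ?thesis
    using CL5_weaken_groups[OF _ cirq, of _ "[]"] by simp
qed

section \<open>Completeness\<close>

lemma vimage_collapse_subset:
  "g \<subseteq> {..<length (p @ [H] @ q)} \<Longrightarrow>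
     collapse (length p) -` g \<subseteq> {..<length (p @ [F, G] @ q)}"
  by (force simp: collapse_less_iff[of "length p", symmetric])

lemma binary_tautology_Or_inversion:
  assumes "binary_tautology (p @ [Or F G] @ q, s)"
  shows "binary_tautology (p @ [F, G] @ q, map (vimage (collapse (length p))) s)"
  unfolding binary_tautology_def
proof (intro conjI)
  show "is_cirquent (p @ [F, G] @ q, map (vimage (collapse (length p))) s)"
    using assms vimage_collapse_subset[of _ p _ q F G] by (auto simp: binary_tautology_def)
  show "binary (p @ [F, G] @ q, map (vimage (collapse (length p))) s)"
    using assms by (simp add: binary_tautology_def binary_def cirquent_occs_def add_ac)
  show "tautology (p @ [F, G] @ q, map (vimage (collapse (length p))) s)"
    using assms by (simp add: binary_tautology_def tautology_def group_true_Or[simplified])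
qed

lemma group_true_split_group:
  assumes "group_true M (p @ [And F G] @ q) g" "h \<in> set (split_group (length p) g)"
  shows "group_true M (p @ [F, G] @ q) h"
  using assms(1)[unfolded group_true_And] assms(2)
  by (auto simp: split_group_def Let_def split: if_splits intro: group_true_mono)

lemma binary_tautology_And_inversion:
  assumes "binary_tautology (p @ [And F G] @ q, s)"
  shows "binary_tautology (p @ [F, G] @ q, concat (map (split_group (length p)) s))"
  unfolding binary_tautology_def
proof (intro conjI)
  have "h \<subseteq> collapse (length p) -` g" if "h \<in> set (split_group (length p) g)" for g h
    using that by (auto simp: split_group_def Let_def split: if_splits)
  then show "is_cirquent (p @ [F, G] @ q, concat (map (split_group (length p)) s))"
    using assms vimage_collapse_subset[of _ p _ q F G]
    by (simp add: binary_tautology_def) (meson order_trans)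
  show "binary (p @ [F, G] @ q, concat (map (split_group (length p)) s))"
    using assms by (simp add: binary_tautology_def binary_def cirquent_occs_def add_ac)
  show "tautology (p @ [F, G] @ q, concat (map (split_group (length p)) s))"
    using assms
    by (auto simp: binary_tautology_def tautology_def intro: group_true_split_group[simplified])
qed

theorem CL5_binary_tautology: "binary_tautology (p, s) \<Longrightarrow> CL5 (p, s)"
proof (induction "sum_list (map size p)" arbitrary: p s rule: less_induct)
  case less
  consider (literals) "\<forall>F\<in>set p. is_literal F"
    | (disjunction) F G where "Or F G \<in> set p"
    | (conjunction) F G where "And F G \<in> set p"
    by (metis formula.exhaust is_literal_def)
  then show ?case
  proof cases
    case literals
    then show ?thesis
      using less.prems by (rule CL5_literals)
  next
    case (disjunction F G)
    then obtain a b where p: "p = a @ [Or F G] @ b"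
      by (metis append_Cons append_Nil split_list)
    have "CL5 (a @ [F, G] @ b, map (vimage (collapse (length a))) s)"
      using less.prems p by (intro less.hyps binary_tautology_Or_inversion) simp_all
    from CL5.or_introduction[OF this] show ?thesis
      using p by (simp add: comp_def)
  next
    case (conjunction F G)
    then obtain a b where p: "p = a @ [And F G] @ b"
      by (metis append_Cons append_Nil split_list)
    have "CL5 (a @ [F, G] @ b, concat (map (split_group (length a)) s))"
      using less.prems p by (intro less.hyps binary_tautology_And_inversion) simp_all
    from CL5.and_introduction[OF this and_ready_split_groups] show ?thesis
      using p by (simp add: merge_split_groups)
  qed
qed

lemma CL5_subst: "CL5 C \<Longrightarrow> CL5 (cirquent_subst \<sigma> C)"
proof (induction rule: CL5.induct)
  case (identity_axiom F)
  show ?case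
    by (simp add: cirquent_subst_def formula_subst_neg CL5.identity_axiom[simplified])
next
  case (mix p s q t)
  then show ?case
    using CL5.mix[of "map (formula_subst \<sigma>) p"] by (simp add: cirquent_subst_def)
next
  case (oformula_exchange p F G q s)
  then show ?case
    using CL5.oformula_exchange[of "map (formula_subst \<sigma>) p"] by (simp add: cirquent_subst_def)
next
  case (pool_weakening p q s F)
  then show ?case
    using CL5.pool_weakening[of "map (formula_subst \<sigma>) p"] by (simp add: cirquent_subst_def)
next
  case (or_introduction p F G q s)
  then show ?case
    using CL5.or_introduction[of "map (formula_subst \<sigma>) p"] by (simp add: cirquent_subst_def)
next
  case (and_introduction p F G q s)
  then show ?case
    using CL5.and_introduction[of "map (formula_subst \<sigma>) p"] by (simp add: cirquent_subst_def)
qed (auto simp: cirquent_subst_def intro: CL5.intros[simplified])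

theorem theorem7p5:
  fixes C :: "'a cirquent"
  assumes "infinite (UNIV :: 'a set)"
    and "is_cirquent C"
  shows "CL5 C \<longleftrightarrow> (\<exists>A :: 'a cirquent. binary_tautology A \<and> instance_of C A)"
proof
  assume "CL5 C"
  then have "has_binary_source {} C"
    using assms(1) by (intro CL5_has_binary_source) simp_all
  then obtain A where "CL5 A" "binary A" "instance_of C A"
    by (auto simp: has_binary_source_def)
  moreover from this have "binary_tautology A"
    by (simp add: binary_tautology_def CL5_is_cirquent CL5_sound)
  ultimately show "\<exists>A :: 'a cirquent. binary_tautology A \<and> instance_of C A"
    by blast
next
  assume "\<exists>A :: 'a cirquent. binary_tautology A \<and> instance_of C A"
  then obtain p s \<sigma> where "binary_tautology (p, s)" "C = cirquent_subst \<sigma> (p, s)"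
    by (auto simp: instance_of_def)
  then show "CL5 C"
    by (simp add: CL5_binary_tautology CL5_subst)
qed

end
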